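(* Let $\boldsymbol{z}=(\bar{\boldsymbol{x}},\bar\eta,\bar\gamma)$ be a range-branching-free (RBF) node solution with respect to some valid $\boldsymbol{w}$. Then $\boldsymbol{z}\in\mathcal{Z}_{LP}(\boldsymbol{w}')$ for all valid $\boldsymbol{w}'$ that satisfy the fractional range-respecting assumption, i.e. for all valid $\boldsymbol{w}'$ such that $(\boldsymbol{x},p_{\max}(\boldsymbol{x}),p_{\min}(\boldsymbol{x}))\in\mathcal{Z}_{LP}(\boldsymbol{w}')$ for every $\boldsymbol{x}\in\mathcal{X}_{LP}$.
   Context: Let $N$ be a positive integer (the number of columns), let $A$ be a real matrix with $N$ columns and $\boldsymbol{b}$ a real vector of matching dimension. Define $\mathcal{X} = \{\boldsymbol{x}\in\{0,1\}^N : A\boldsymbol{x}\le \boldsymbol{b}\}$ and $\mathcal{X}_{LP}=\{\boldsymbol{x}\in[0,1]^N : A\boldsymbol{x}\le \boldsymbol{b}\}$. Each column $i\in\{1,\dots,N\}$ has a payoff $p_i\in[0,M]$ for some constant $M$; write $\boldsymbol{p}=(p_1,\dots,p_N)$. For $\boldsymbol{x}\in[0,1]^N$ define $p_{\min}(\boldsymbol{x})=\min_{i: x_i>0}p_i$ and $p_{\max}(\boldsymbol{x})=\max_{i:x_i>0}p_i$. Range-respecting/range-violating: a vector $(\boldsymbol{x},\eta,\gamma)\in[0,1]^N\times\mathbb{R}^2$ is range-respecting (with respect to $\boldsymbol{p}$) if $\eta\ge p_{\max}(\boldsymbol{x})$ and $\gamma\le p_{\min}(\boldsymbol{x})$, and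 range-violating otherwise. Valid formulation: let $\boldsymbol{w}=(C,\boldsymbol{d},\boldsymbol{f},\boldsymbol{g})$ be a tuple consisting of a real matrix $C$ with $N$ columns and real vectors $\boldsymbol{d},\boldsymbol{f},\boldsymbol{g}$ of matching dimension. It defines the mixed-binary linear program $$\min_{\boldsymbol{x},\eta,\gamma}\ \eta-\gamma\quad\text{s.t.}\quad A\boldsymbol{x}\le\boldsymbol{b},\quad C\boldsymbol{x}+\eta\boldsymbol{d}+\gamma\boldsymbol{f}\le\boldsymbol{g},\quad \boldsymbol{x}\in\{0,1\}^N,\ \eta,\gamma\in\mathbb{R}.$$ The program is a valid formulation (and $\boldsymbol{w}$ is called valid) when $(\boldsymbol{x},\eta,\gamma)$ is feasible in it if and only if $\boldsymbol{x}\in\mathcal{X}$ and $(\boldsymbol{x},\eta,\gamma)$ is range-respecting. $\mathcal{Z}_{LP}(\boldsymbol{w})$ denotes the feasible region of its LP relaxation, obtained by replacing $\boldsymbol{x}\in\{0,1\}^N$ by $\boldsymbol{x}\in[0,1]^N$. The matrices $A$, vector $\boldsymbol{b}$ and payoffs $\boldsymbol{p}$ are fixed; different tuples $\boldsymbol{w},\boldsymbol{w}'$ (possibly with different numbers of constraints) give different formulations. Range branching: the program defined by $\boldsymbol{w}$ is solved by LP-based branch and bound (branch and price). At every node one solves the LP relaxation with feasible region $\mathcal{Z}_{LP}(\boldsymbol{w})$ together with the additional restrictions imposed by the branching decisions on the path from the root to that node; let $(\bar{\boldsymbol{x}},\bar\eta,\bar\gamma)$ be the solution obtained (in particular it lies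 in $\mathcal{Z}_{LP}(\boldsymbol{w})$). The range branching rule is invoked first at each node: - If $\bar\eta<p_{\max}(\bar{\boldsymbol{x}})$, it can branch by choosing a cutoff $U\in(\bar\eta,p_{\max}(\bar{\boldsymbol{x}}))$ and creating two children: one imposing $\eta\le U$ and $x_i=0$ for all $i$ with $p_i>U$, the other imposing $\eta\ge U$. - If $\bar\gamma>p_{\min}(\bar{\boldsymbol{x}})$, it can branch by choosing a cutoff $L\in(p_{\min}(\bar{\boldsymbol{x}}),\bar\gamma)$ and creating two children: one imposing $\gamma\ge L$ and $x_i=0$ for all $i$ with $p_i<L$, the other imposing $\gamma\le L$. - If neither inequality holds, the rule creates no branches (it detects no branching opportunity), and a problem-specific branching scheme is used instead. An RBF node solution with respect to $\boldsymbol{w}$ is any solution vector $(\bar{\boldsymbol{x}},\bar\eta,\bar\gamma)$ encountered at any node of the branch-and-bound tree when solving the formulation defined by $\boldsymbol{w}$, for which the range branching rule does not detect any branching opportunity.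
   Formalization: The formal theorem additionally assumes that the binary feasible set X is nonempty; if X is empty while X_LP is not, every w is valid and the claim fails (e.g. N=1, X_LP={1/2}, p=0, w: η≥5, γ≤0, w': η≤0, γ≤0). *)

theory Defs
  imports "Jordan_Normal_Form.Matrix"
begin

text \<open>Points \<open>(x, \<eta>, \<gamma>)\<close>, and tuples \<open>(C, d, f, g)\<close> describing the constraints
  \<open>C x + \<eta> d + \<gamma> f \<le> g\<close>. The number of rows is read off from the matrix, so tuples of
  different sizes share one type. The order on \<^typ>\<open>real vec\<close> is componentwise and demands
  equal dimensions.\<close>

type_synonym point = "real vec \<times> real \<times> real"
type_synonym formulation = "real mat \<times> real vec \<times> real vec \<times> real vec"

definition binary_cube :: "nat \<Rightarrow> real vec set" where
  "binary_cube N = {x \<in> carrier_vec N. \<forall>i<N. x $ i \<in> {0, 1}}"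

definition unit_cube :: "nat \<Rightarrow> real vec set" where
  "unit_cube N = {x \<in> carrier_vec N. \<forall>i<N. x $ i \<in> {0..1}}"

definition X_bin :: "nat \<Rightarrow> real mat \<Rightarrow> real vec \<Rightarrow> real vec set" where
  "X_bin N A b = {x \<in> binary_cube N. A *\<^sub>v x \<le> b}"

definition X_LP :: "nat \<Rightarrow> real mat \<Rightarrow> real vec \<Rightarrow> real vec set" where
  "X_LP N A b = {x \<in> unit_cube N. A *\<^sub>v x \<le> b}"

text \<open>For \<open>x = 0\<close> the maximum and the minimum range over the empty set. The value taken there is
  a parameter (\<open>pmax0\<close> resp. \<open>pmin0\<close>); for payoffs in \<open>[0, M]\<close> the lattice convention is
  \<open>pmax0 = 0\<close> and \<open>pmin0 = M\<close>.\<close>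

definition support_payoffs :: "real vec \<Rightarrow> real vec \<Rightarrow> real set" where
  "support_payoffs p x = {p $ i | i. i < dim_vec p \<and> x $ i > 0}"

definition p_max :: "real \<Rightarrow> real vec \<Rightarrow> real vec \<Rightarrow> real" where
  "p_max pmax0 p x = (if support_payoffs p x = {} then pmax0 else Max (support_payoffs p x))"

definition p_min :: "real \<Rightarrow> real vec \<Rightarrow> real vec \<Rightarrow> real" where
  "p_min pmin0 p x = (if support_payoffs p x = {} then pmin0 else Min (support_payoffs p x))"

definition range_respecting :: "real \<Rightarrow> real \<Rightarrow> real vec \<Rightarrow> point \<Rightarrow> bool" where
  "range_respecting pmax0 pmin0 p = (\<lambda>(x, \<eta>, \<gamma>). \<eta> \<ge> p_max pmax0 p x \<and> \<gamma> \<le> p_min pmin0 p x)"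

definition well_formed :: "nat \<Rightarrow> formulation \<Rightarrow> bool" where
  "well_formed N = (\<lambda>(C, d, f, g). \<exists>k. C \<in> carrier_mat k N \<and>
     d \<in> carrier_vec k \<and> f \<in> carrier_vec k \<and> g \<in> carrier_vec k)"

definition satisfies :: "formulation \<Rightarrow> point \<Rightarrow> bool" where
  "satisfies = (\<lambda>(C, d, f, g) (x, \<eta>, \<gamma>). C *\<^sub>v x + \<eta> \<cdot>\<^sub>v d + \<gamma> \<cdot>\<^sub>v f \<le> g)"

definition Z_bin :: "nat \<Rightarrow> real mat \<Rightarrow> real vec \<Rightarrow> formulation \<Rightarrow> point set" where
  "Z_bin N A b w = {(x, \<eta>, \<gamma>). x \<in> binary_cube N \<and> A *\<^sub>v x \<le> b \<and> satisfies w (x, \<eta>, \<gamma>)}"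

definition Z_LP :: "nat \<Rightarrow> real mat \<Rightarrow> real vec \<Rightarrow> formulation \<Rightarrow> point set" where
  "Z_LP N A b w = {(x, \<eta>, \<gamma>). x \<in> unit_cube N \<and> A *\<^sub>v x \<le> b \<and> satisfies w (x, \<eta>, \<gamma>)}"

definition valid ::
  "nat \<Rightarrow> real mat \<Rightarrow> real vec \<Rightarrow> real vec \<Rightarrow> real \<Rightarrow> real \<Rightarrow> formulation \<Rightarrow> bool" where
  "valid N A b p pmax0 pmin0 w \<longleftrightarrow> well_formed N w \<and>
     (\<forall>x \<eta> \<gamma>. (x, \<eta>, \<gamma>) \<in> Z_bin N A b w \<longleftrightarrow>
        x \<in> X_bin N A b \<and> range_respecting pmax0 pmin0 p (x, \<eta>, \<gamma>))"

definition fractional_range_respecting ::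
  "nat \<Rightarrow> real mat \<Rightarrow> real vec \<Rightarrow> real vec \<Rightarrow> real \<Rightarrow> real \<Rightarrow> formulation \<Rightarrow> bool" where
  "fractional_range_respecting N A b p pmax0 pmin0 w \<longleftrightarrow>
     (\<forall>x \<in> X_LP N A b. (x, p_max pmax0 p x, p_min pmin0 p x) \<in> Z_LP N A b w)"

text \<open>A node of the branch-and-bound tree is given by the list of restrictions (each a set of
  points) imposed on the path from the root to it, the most recent one first. Its LP relaxation
  minimises \<open>\<eta> - \<gamma>\<close>.\<close>

definition objective :: "point \<Rightarrow> real" where
  "objective = (\<lambda>(x, \<eta>, \<gamma>). \<eta> - \<gamma>)"

definition node_region ::
  "nat \<Rightarrow> real mat \<Rightarrow> real vec \<Rightarrow> formulation \<Rightarrow> point set list \<Rightarrow> point set" where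
  "node_region N A b w \<pi> = Z_LP N A b w \<inter> \<Inter> (set \<pi>)"

definition node_solution ::
  "nat \<Rightarrow> real mat \<Rightarrow> real vec \<Rightarrow> formulation \<Rightarrow> point set list \<Rightarrow> point \<Rightarrow> bool" where
  "node_solution N A b w \<pi> z \<longleftrightarrow> is_arg_min objective (\<lambda>y. y \<in> node_region N A b w \<pi>) z"

definition upper_opportunity :: "real \<Rightarrow> real vec \<Rightarrow> point \<Rightarrow> bool" where
  "upper_opportunity pmax0 p = (\<lambda>(x, \<eta>, \<gamma>). \<eta> < p_max pmax0 p x)"

definition lower_opportunity :: "real \<Rightarrow> real vec \<Rightarrow> point \<Rightarrow> bool" where
  "lower_opportunity pmin0 p = (\<lambda>(x, \<eta>, \<gamma>). \<gamma> > p_min pmin0 p x)"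

definition branch_upper :: "real vec \<Rightarrow> real \<Rightarrow> point set set" where
  "branch_upper p U =
     {{(x, \<eta>, \<gamma>). \<eta> \<le> U \<and> (\<forall>i<dim_vec p. p $ i > U \<longrightarrow> x $ i = 0)}, {(x, \<eta>, \<gamma>). \<eta> \<ge> U}}"

definition branch_lower :: "real vec \<Rightarrow> real \<Rightarrow> point set set" where
  "branch_lower p L =
     {{(x, \<eta>, \<gamma>). \<gamma> \<ge> L \<and> (\<forall>i<dim_vec p. p $ i < L \<longrightarrow> x $ i = 0)}, {(x, \<eta>, \<gamma>). \<gamma> \<le> L}}"

text \<open>The problem-specific branching scheme is an arbitrary function from a node and its solution
  to the restrictions defining the children; it returns \<open>{}\<close> where the node is not branched.
  The choices left open by the algorithm (optimal solution returned, branching direction, cutoff)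
  are nondeterministic: \<open>bb_node\<close> holds of the nodes of all trees the algorithm can produce.\<close>

type_synonym branching_scheme = "point set list \<Rightarrow> point \<Rightarrow> point set set"

inductive bb_node ::
  "nat \<Rightarrow> real mat \<Rightarrow> real vec \<Rightarrow> real vec \<Rightarrow> real \<Rightarrow> real \<Rightarrow> branching_scheme \<Rightarrow> formulation \<Rightarrow>
   point set list \<Rightarrow> bool"
  for N A b p pmax0 pmin0 scheme w where
  root: "bb_node N A b p pmax0 pmin0 scheme w []"
| upper: "bb_node N A b p pmax0 pmin0 scheme w (R # \<pi>)"
  if "bb_node N A b p pmax0 pmin0 scheme w \<pi>" "node_solution N A b w \<pi> (x, \<eta>, \<gamma>)"
    "upper_opportunity pmax0 p (x, \<eta>, \<gamma>)" "U \<in> {\<eta> <..< p_max pmax0 p x}" "R \<in> branch_upper p U"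
| lower: "bb_node N A b p pmax0 pmin0 scheme w (R # \<pi>)"
  if "bb_node N A b p pmax0 pmin0 scheme w \<pi>" "node_solution N A b w \<pi> (x, \<eta>, \<gamma>)"
    "lower_opportunity pmin0 p (x, \<eta>, \<gamma>)" "L \<in> {p_min pmin0 p x <..< \<gamma>}" "R \<in> branch_lower p L"
| specific: "bb_node N A b p pmax0 pmin0 scheme w (R # \<pi>)"
  if "bb_node N A b p pmax0 pmin0 scheme w \<pi>" "node_solution N A b w \<pi> z"
    "\<not> upper_opportunity pmax0 p z" "\<not> lower_opportunity pmin0 p z" "R \<in> scheme \<pi> z"

definition RBF_node_solution ::
  "nat \<Rightarrow> real mat \<Rightarrow> real vec \<Rightarrow> real vec \<Rightarrow> real \<Rightarrow> real \<Rightarrow> branching_scheme \<Rightarrow> formulation \<Rightarrow>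
   point \<Rightarrow> bool" where
  "RBF_node_solution N A b p pmax0 pmin0 scheme w z \<longleftrightarrow>
     (\<exists>\<pi>. bb_node N A b p pmax0 pmin0 scheme w \<pi> \<and> node_solution N A b w \<pi> z) \<and>
     \<not> upper_opportunity pmax0 p z \<and> \<not> lower_opportunity pmin0 p z"

end

theory Submission
  imports Defs
begin

text \<open>The range-respecting points over a fixed binary \<open>x\<close> form a translated cone: \<open>\<eta>\<close> may be
  raised and \<open>\<gamma>\<close> lowered without limit. If \<open>X_bin\<close> is nonempty, every valid formulation must
  admit such a cone, so \<open>(0, 1, 0)\<close> and \<open>(0, 0, -1)\<close> are recession directions of its linear
  constraints, i.e. \<open>d \<le> 0 \<le> f\<close> row by row (lemma \<open>valid_coefficient_signs\<close>). Recession directions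
  do not depend on the base point, so the relaxation \<open>Z_LP\<close> is closed under these moves for
  fractional \<open>x\<close> as well (lemma \<open>Z_LP_widen_range\<close>).

  A solution without a range branching opportunity is range-respecting, and its \<open>x\<close> lies in \<open>X_LP\<close>.
  It therefore arises by widening the range of \<open>(x, p_max x, p_min x)\<close>, which is in the
  relaxation of \<open>w'\<close> by the fractional range-respecting assumption.\<close>

lemma slope_nonpos_if_bounded_above:
  fixes c d g :: real
  assumes "\<And>t. t \<ge> 0 \<Longrightarrow> c + t * d \<le> g"
  shows "d \<le> 0"
proof (rule ccontr)
  assume "\<not> d \<le> 0"
  hence "d > 0" by simp
  hence "c + (\<bar>g - c\<bar> / d + 1) * d = c + \<bar>g - c\<bar> + d" by (simp add: field_simps)
  moreover have "c + (\<bar>g - c\<bar> / d + 1) * d \<le> g"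
    using \<open>d > 0\<close> by (intro assms) simp
  ultimately show False using \<open>d > 0\<close> by linarith
qed

lemma satisfies_iff_rows:
  assumes "C \<in> carrier_mat k N" "d \<in> carrier_vec k" "f \<in> carrier_vec k" "g \<in> carrier_vec k"
  shows "satisfies (C, d, f, g) (x, \<eta>, \<gamma>) \<longleftrightarrow>
    (\<forall>i<k. (C *\<^sub>v x) $ i + \<eta> * d $ i + \<gamma> * f $ i \<le> g $ i)"
  using assms by (auto simp: satisfies_def less_eq_vec_def)

text \<open>Along the two unbounded directions of the range-respecting points over some binary \<open>x\<close>, the
  left-hand side of every row is affine and bounded above by the right-hand side, which fixes the
  sign of its slope. Without a point in \<open>X_bin\<close> the signs would be arbitrary.\<close>

lemma valid_coefficient_signs:
  assumes valid: "valid N A b p pmax0 pmin0 (C, d, f, g)" and nonempty: "X_bin N A b \<noteq> {}"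
    and dims: "C \<in> carrier_mat k N" "d \<in> carrier_vec k" "f \<in> carrier_vec k" "g \<in> carrier_vec k"
    and i: "i < k"
  shows "d $ i \<le> 0" and "f $ i \<ge> 0"
proof -
  obtain x where x: "x \<in> X_bin N A b" using nonempty by blast
  let ?u = "p_max pmax0 p x" and ?l = "p_min pmin0 p x"
  have row: "(C *\<^sub>v x) $ i + (?u + s) * d $ i + (?l - t) * f $ i \<le> g $ i"
    if "s \<ge> 0" "t \<ge> 0" for s t
  proof -
    have "range_respecting pmax0 pmin0 p (x, ?u + s, ?l - t)"
      using that by (simp add: range_respecting_def)
    hence "(x, ?u + s, ?l - t) \<in> Z_bin N A b (C, d, f, g)"
      using valid x unfolding valid_def by blast
    thus ?thesis using i by (simp add: Z_bin_def satisfies_iff_rows[OF dims])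
  qed
  let ?c = "(C *\<^sub>v x) $ i + ?u * d $ i + ?l * f $ i"
  show "d $ i \<le> 0"
  proof (rule slope_nonpos_if_bounded_above)
    show "?c + s * d $ i \<le> g $ i" if "s \<ge> 0" for s
      using row[of s 0] that by (simp add: algebra_simps)
  qed
  have "- f $ i \<le> 0"
  proof (rule slope_nonpos_if_bounded_above)
    show "?c + t * (- f $ i) \<le> g $ i" if "t \<ge> 0" for t
      using row[of 0 t] that by (simp add: algebra_simps)
  qed
  thus "f $ i \<ge> 0" by simp
qed

text \<open>Validity constrains binary points only; it reaches fractional \<open>x\<close> because the signs of \<open>d\<close>
  and \<open>f\<close> do not involve \<open>x\<close>.\<close>

lemma Z_LP_widen_range:
  assumes valid: "valid N A b p pmax0 pmin0 w" and nonempty: "X_bin N A b \<noteq> {}"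
    and mem: "(x, \<eta>, \<gamma>) \<in> Z_LP N A b w"
    and le: "\<eta> \<le> \<eta>'" "\<gamma>' \<le> \<gamma>"
  shows "(x, \<eta>', \<gamma>') \<in> Z_LP N A b w"
proof -
  obtain C d f g where w: "w = (C, d, f, g)" by (metis prod_cases4)
  obtain k where dims: "C \<in> carrier_mat k N" "d \<in> carrier_vec k" "f \<in> carrier_vec k"
      "g \<in> carrier_vec k"
    using valid by (auto simp: w valid_def well_formed_def)
  note signs = valid_coefficient_signs[OF valid[unfolded w] nonempty dims]
  have "(C *\<^sub>v x) $ i + \<eta>' * d $ i + \<gamma>' * f $ i \<le> g $ i" if "i < k" for i
  proof -
    have "\<eta>' * d $ i \<le> \<eta> * d $ i"
      using le(1) signs(1)[OF that] by (rule mult_right_mono_neg)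
    moreover have "\<gamma>' * f $ i \<le> \<gamma> * f $ i"
      using le(2) signs(2)[OF that] by (rule mult_right_mono)
    moreover have "(C *\<^sub>v x) $ i + \<eta> * d $ i + \<gamma> * f $ i \<le> g $ i"
      using mem that by (simp add: w Z_LP_def satisfies_iff_rows[OF dims])
    ultimately show ?thesis by linarith
  qed
  thus ?thesis using mem by (simp add: w Z_LP_def satisfies_iff_rows[OF dims])
qed

lemma RBF_node_solution_range_respecting:
  assumes "RBF_node_solution N A b p pmax0 pmin0 scheme w (x, \<eta>, \<gamma>)"
  shows "x \<in> X_LP N A b" and "p_max pmax0 p x \<le> \<eta>" and "\<gamma> \<le> p_min pmin0 p x"
  using assms
  by (auto simp: RBF_node_solution_def node_solution_def is_arg_min_def node_region_def
      Z_LP_def X_LP_def upper_opportunity_def lower_opportunity_def)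

theorem corollary4:
  fixes N m :: nat and A :: "real mat" and b p :: "real vec" and M pmax0 pmin0 :: real
    and scheme :: branching_scheme and w :: formulation
    and x :: "real vec" and \<eta> \<gamma> :: real
  assumes "N > 0" and "A \<in> carrier_mat m N" and "b \<in> carrier_vec m" and "p \<in> carrier_vec N"
    and "\<forall>i<N. p $ i \<in> {0..M}"
    and "X_bin N A b \<noteq> {}"
    and "valid N A b p pmax0 pmin0 w"
    and "RBF_node_solution N A b p pmax0 pmin0 scheme w (x, \<eta>, \<gamma>)"
  shows "\<forall>w'. valid N A b p pmax0 pmin0 w' \<and> fractional_range_respecting N A b p pmax0 pmin0 w' \<longrightarrow>
    (x, \<eta>, \<gamma>) \<in> Z_LP N A b w'"
proof (intro allI impI, elim conjE)
  fix w'
  assume valid': "valid N A b p pmax0 pmin0 w'"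
    and frr: "fractional_range_respecting N A b p pmax0 pmin0 w'"
  note z = RBF_node_solution_range_respecting[OF assms(8)]
  have "(x, p_max pmax0 p x, p_min pmin0 p x) \<in> Z_LP N A b w'"
    using frr z(1) by (simp add: fractional_range_respecting_def)
  thus "(x, \<eta>, \<gamma>) \<in> Z_LP N A b w'"
    using Z_LP_widen_range[OF valid' assms(6)] z(2,3) by blast
qed

end
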